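(* Let $d\ge1$, let $X^0,X^1,\dots,X^d$ be subsets of $[0,1]^d$ and let $p\in[0,1]^d$. Assume that $p\in\operatorname{conv}_{\oplus}(X^i)$ for all $0\le i\le d$. Then, up to a permutation of the indices of the sets $X^0,\dots,X^d$, there exist $x^i\in X^i$, $i\in I(p)$, such that $p\in\operatorname{conv}_{\oplus}(\{x^i : i\in I(p)\})$. (That is, there are a permutation $\sigma$ of $\{0,\dots,d\}$ and points $x^i\in X^{\sigma(i)}$, $i\in I(p)$, with this property.)
   Context: For $a,b\in[0,1]$ put $a\oplus b=\max(a,b)$ and $a\otimes b=\min(a,b)$; these act on vectors of $[0,1]^d$ componentwise, with $(\lambda\otimes x)_k=\min(\lambda,x_k)$ for $\lambda\in[0,1]$, $x\in[0,1]^d$. A set $C\subseteq[0,1]^d$ is max-min convex if for all $x,y\in C$ and all $\alpha,\beta\in[0,1]$ with $\alpha\oplus\beta=1$ one has $\alpha\otimes x\oplus\beta\otimes y\in C$. For $X\subseteq[0,1]^d$, the convex hull $\operatorname{conv}_{\oplus}(X)$ is the smallest max-min convex set containing $X$; equivalently, the set of all combinations $\bigoplus_{i=1}^m\lambda_i\otimes x^i$ with $m\ge1$, $x^i\in X$, $\lambda_i\in[0,1]$, $\bigoplus_{i=1}^m\lambda_i=1$. For $p\in[0,1]^d$, $I(p)\subseteq\{0,1,\dots,d\}$ denotes the set consisting of all $i\in\{1,\dots,d\}$ with $p_i>0$, together with $0$ in the case when no coordinate of $p$ equals $1$. *)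

theory Defs
  imports Complex_Main "HOL-Library.FuncSet" "HOL-Combinatorics.Permutations"
begin

text \<open>
  Points of \<open>[0,1]\<^sup>d\<close> are functions on \<open>{1..d}\<close>, made extensional (\<open>undefined\<close> outside
  \<open>{1..d}\<close>) so that equality of points is equality of their \<open>d\<close> coordinates.
\<close>

definition unit_cube :: "nat \<Rightarrow> (nat \<Rightarrow> real) set" where
  "unit_cube d = {1..d} \<rightarrow>\<^sub>E {0..1}"

definition mm_add :: "nat \<Rightarrow> (nat \<Rightarrow> real) \<Rightarrow> (nat \<Rightarrow> real) \<Rightarrow> nat \<Rightarrow> real" where
  "mm_add d x y = (\<lambda>k\<in>{1..d}. max (x k) (y k))"

definition mm_scale :: "nat \<Rightarrow> real \<Rightarrow> (nat \<Rightarrow> real) \<Rightarrow> nat \<Rightarrow> real" where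
  "mm_scale d a x = (\<lambda>k\<in>{1..d}. min a (x k))"

definition mm_convex :: "nat \<Rightarrow> (nat \<Rightarrow> real) set \<Rightarrow> bool" where
  "mm_convex d C \<longleftrightarrow> C \<subseteq> unit_cube d \<and>
     (\<forall>x\<in>C. \<forall>y\<in>C. \<forall>a\<in>{0..1}. \<forall>b\<in>{0..1}. max a b = 1 \<longrightarrow>
        mm_add d (mm_scale d a x) (mm_scale d b y) \<in> C)"

text \<open>
  Only meaningful for \<open>X \<subseteq> unit_cube d\<close>; otherwise no max-min convex set contains \<open>X\<close> and
  the hull degenerates to \<open>UNIV\<close>.
\<close>

definition mm_conv :: "nat \<Rightarrow> (nat \<Rightarrow> real) set \<Rightarrow> (nat \<Rightarrow> real) set" where
  "mm_conv d X = mm_convex d hull X"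

definition index_set :: "nat \<Rightarrow> (nat \<Rightarrow> real) \<Rightarrow> nat set" where
  "index_set d p =
     {i \<in> {1..d}. p i > 0} \<union> (if \<exists>k\<in>{1..d}. p k = 1 then {} else {0})"

lemma mm_convex_unit_cube: "mm_convex d (unit_cube d)"
  by (auto simp: mm_convex_def unit_cube_def mm_add_def mm_scale_def PiE_iff
      le_max_iff_disj min_le_iff_disj)

lemma mm_convex_mm_conv:
  assumes "X \<subseteq> unit_cube d"
  shows "mm_convex d (mm_conv d X)"
proof -
  have "unit_cube d \<in> {t. mm_convex d t \<and> X \<subseteq> t}"
    using assms mm_convex_unit_cube by blast
  then show ?thesis
    unfolding mm_conv_def hull_def mm_convex_def by blast
qed

lemma mm_conv_superset: "X \<subseteq> mm_conv d X"
  by (simp add: mm_conv_def hull_subset)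

lemma mm_conv_least: "mm_convex d C \<Longrightarrow> X \<subseteq> C \<Longrightarrow> mm_conv d X \<subseteq> C"
  by (simp add: mm_conv_def hull_minimal)

end

theory Submission imports Defs begin

text \<open>
  Membership of \<open>p\<close> in a max-min convex hull splits into independent conditions indexed by
  \<open>index_set d p\<close>, each asking for a single generator lying in a certain sector at \<open>p\<close>. The
  complement of a sector is a max-min convex set not containing \<open>p\<close>, so a set whose hull
  contains \<open>p\<close> meets every sector; conversely, one point from each sector suffices to
  generate \<open>p\<close>, the point for \<open>i > 0\<close> being used with coefficient \<open>p\<^sub>i\<close> and a point below
  \<open>p\<close> with coefficient \<open>1\<close>. Hence \<open>x\<^sup>i\<close> can be taken in \<open>X\<^sup>i\<close> itself, and the permutation is
  the identity.
\<close>

text \<open>For \<open>i\<close> in \<open>{1..d}\<close> these are the points whose truncation at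
  height \<open>p i\<close> lies below \<open>p\<close> and agrees with \<open>p\<close> in
  coordinate \<open>i\<close>. Index 0 is the analogue for coefficient 1: points of the cube already
  below \<open>p\<close>.\<close>

definition sector :: "nat \<Rightarrow> (nat \<Rightarrow> real) \<Rightarrow> nat \<Rightarrow> (nat \<Rightarrow> real) set" where
  "sector d p i =
     (if i = 0 then {x. \<forall>j\<in>{1..d}. x j \<le> p j}
      else {x. p i \<le> x i \<and> (\<forall>j\<in>{1..d}. p j < p i \<longrightarrow> x j \<le> p j)})"

lemma mem_sector_self: "p \<in> sector d p i"
  by (simp add: sector_def)

text \<open>One coefficient equals 1, so that point lies below the combination and inherits all its
  upper bounds. If it falls short of \<open>p i\<close> in coordinate \<open>i\<close>, the other
  point must supply that height.\<close>

lemma mm_combination_mem_sectorD: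
  assumes "i \<in> {0..d}" and "max a b = 1"
    and "x \<in> unit_cube d" and "y \<in> unit_cube d"
    and "mm_add d (mm_scale d a x) (mm_scale d b y) \<in> sector d p i"
  shows "x \<in> sector d p i \<or> y \<in> sector d p i"
proof -
  \<comment> \<open>The case where \<open>x\<close> carries the coefficient 1; all variables are
    general so that it also covers the swapped roles.\<close>
  have *: "x \<in> sector d p i \<or> y \<in> sector d p i"
    if x: "x \<in> unit_cube d"
      and z: "\<And>j. j \<in> {1..d} \<Longrightarrow> z j = max (min 1 (x j)) (min b (y j))"
      and zs: "z \<in> sector d p i" for b x y z
  proof -
    have x1: "x j \<le> 1" if "j \<in> {1..d}" for j
      using x that by (auto simp: unit_cube_def PiE_iff)
    have z': "z j = max (x j) (min b (y j))" if "j \<in> {1..d}" for j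
      using x1[OF that] z[OF that] by simp
    show ?thesis
    proof (cases "i = 0")
      case True
      then show ?thesis using zs z' by (auto simp: sector_def)
    next
      case False
      then have i: "i \<in> {1..d}" using assms(1) by auto
      have zi: "p i \<le> max (x i) (min b (y i))"
        using zs z'[OF i] False by (simp add: sector_def)
      have zj: "x j \<le> p j \<and> min b (y j) \<le> p j" if "j \<in> {1..d}" "p j < p i" for j
      proof -
        have "z j \<le> p j" using zs that False by (auto simp: sector_def)
        then show ?thesis using z'[OF that(1)] by simp
      qed
      show ?thesis
      proof (cases "p i \<le> x i")
        case True
        then show ?thesis using zj False by (simp add: sector_def)
      next
        case nx: False
        then have "p i \<le> b" "p i \<le> y i" using zi by auto
        \<comment> \<open>Since \<open>p j < p i \<le> b\<close>, a minimum with \<open>b\<close>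
          that is at most \<open>p j\<close> must be attained by \<open>y j\<close>.\<close>
        moreover have "y j \<le> p j" if "j \<in> {1..d}" "p j < p i" for j
          using zj[OF that] that \<open>p i \<le> b\<close> by auto
        ultimately show ?thesis using False by (simp add: sector_def)
      qed
    qed
  qed
  let ?z = "mm_add d (mm_scale d a x) (mm_scale d b y)"
  from assms(2) consider "a = 1" | "b = 1" by (auto simp: max_def split: if_splits)
  then show ?thesis
  proof cases
    case 1
    show ?thesis
      by (rule *[OF assms(3) _ assms(5), where b = b])
        (simp add: 1 mm_add_def mm_scale_def)
  next
    case 2
    have "y \<in> sector d p i \<or> x \<in> sector d p i"
      by (rule *[OF assms(4) _ assms(5), where b = a])
        (simp add: 2 mm_add_def mm_scale_def max.commute)
    then show ?thesis by blast
  qed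
qed

lemma mm_convex_Diff_sector:
  assumes "i \<in> {0..d}"
  shows "mm_convex d (unit_cube d - sector d p i)"
  unfolding mm_convex_def
proof (intro conjI ballI impI)
  fix x y a b
  assume xy: "x \<in> unit_cube d - sector d p i" "y \<in> unit_cube d - sector d p i"
    and ab: "a \<in> {0..1::real}" "b \<in> {0..1::real}" "max a b = 1"
  let ?z = "mm_add d (mm_scale d a x) (mm_scale d b y)"
  have "?z \<in> unit_cube d"
    using mm_convex_unit_cube[of d] xy ab by (simp add: mm_convex_def)
  moreover have "?z \<notin> sector d p i"
    using mm_combination_mem_sectorD[OF assms ab(3)] xy by blast
  ultimately show "?z \<in> unit_cube d - sector d p i" by blast
qed blast

lemma mem_mm_conv_meets_sector:
  assumes "X \<subseteq> unit_cube d" and "p \<in> mm_conv d X" and "i \<in> {0..d}"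
  shows "\<exists>x\<in>X. x \<in> sector d p i"
proof (rule ccontr)
  assume "\<not> ?thesis"
  then have "X \<subseteq> unit_cube d - sector d p i" using assms(1) by blast
  from mm_conv_least[OF mm_convex_Diff_sector[OF assms(3)] this] show False
    using assms(2) mem_sector_self by blast
qed

text \<open>Starting from a point of \<open>C\<close> below \<open>p\<close>, the coordinates with
  \<open>p i > 0\<close> are raised to \<open>p i\<close> one at a time, never exceeding
  \<open>p\<close>.\<close>

lemma mm_convex_mem_if_meets_sectors:
  assumes C: "mm_convex d C" and p: "p \<in> unit_cube d"
    and sectors: "\<And>i. i \<in> index_set d p \<Longrightarrow> \<exists>x\<in>C. x \<in> sector d p i"
  shows "p \<in> C"
proof -
  have cube: "C \<subseteq> unit_cube d" using C by (simp add: mm_convex_def)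
  have p01: "0 \<le> p j" "p j \<le> 1" if "j \<in> {1..d}" for j
    using p that by (auto simp: unit_cube_def PiE_iff)
  have C01: "0 \<le> x j" "x j \<le> 1" if "x \<in> C" "j \<in> {1..d}" for x j
    using cube that by (auto simp: unit_cube_def PiE_iff dest!: subsetD)
  \<comment> \<open>If some \<open>p k = 1\<close>, index 0 is absent, but sector \<open>k\<close>
    serves instead: it bounds the coordinates with \<open>p j < 1\<close>, and the cube bounds the
    rest.\<close>
  have base: "\<exists>x\<in>C. \<forall>j\<in>{1..d}. x j \<le> p j"
  proof (cases "\<exists>k\<in>{1..d}. p k = 1")
    case True
    then obtain k where k: "k \<in> {1..d}" "p k = 1" by blast
    then obtain x where x: "x \<in> C" "x \<in> sector d p k"
      using sectors[of k] by (auto simp: index_set_def)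
    have "x j \<le> p j" if "j \<in> {1..d}" for j
      using x k that p01[OF that] C01[OF x(1) that] by (cases "p j = 1") (auto simp: sector_def)
    then show ?thesis using x(1) by blast
  next
    case False
    then show ?thesis using sectors[of 0] by (auto simp: index_set_def sector_def)
  qed
  have "\<exists>z\<in>C. (\<forall>j\<in>{1..d}. z j \<le> p j) \<and> (\<forall>i\<in>J. p i \<le> z i)"
    if "finite J" "J \<subseteq> {i\<in>{1..d}. p i > 0}" for J
    using that
  proof (induction J rule: finite_induct)
    case empty
    then show ?case using base by simp
  next
    case (insert i J)
    then obtain z where z: "z \<in> C" "\<forall>j\<in>{1..d}. z j \<le> p j" "\<forall>j\<in>J. p j \<le> z j"
      by auto
    have i: "i \<in> {1..d}" "p i > 0" using insert.prems by auto
    then obtain x where x: "x \<in> C" "x \<in> sector d p i"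
      using sectors[of i] by (auto simp: index_set_def)
    have xi: "p i \<le> x i" and xj: "\<And>j. j \<in> {1..d} \<Longrightarrow> p j < p i \<Longrightarrow> x j \<le> p j"
      using x(2) i by (auto simp: sector_def)
    \<comment> \<open>Coefficient 1 makes the combination admissible and keeps what \<open>z\<close>
      has reached. The cap \<open>p i\<close> protects coordinates with
      \<open>p j \<ge> p i\<close>; the sector protects the others.\<close>
    let ?w = "mm_add d (mm_scale d 1 z) (mm_scale d (p i) x)"
    have "?w \<in> C"
      using C z(1) x(1) p01[OF i(1)] by (simp add: mm_convex_def)
    moreover have w: "?w j = max (z j) (min (p i) (x j))" if "j \<in> {1..d}" for j
      using that C01[OF z(1) that] by (simp add: mm_add_def mm_scale_def)
    have "?w j \<le> p j" if "j \<in> {1..d}" for j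
      using w[OF that] z(2) xj[OF that] that by (cases "p j < p i") auto
    moreover have "p j \<le> ?w j" if "j \<in> insert i J" for j
    proof -
      have "j \<in> {1..d}" using that insert.prems by auto
      then show ?thesis using w that z(3) xi by (auto simp: le_max_iff_disj)
    qed
    ultimately show ?case by blast
  qed
  from this[of "{i\<in>{1..d}. p i > 0}"] obtain z
    where z: "z \<in> C" "\<forall>j\<in>{1..d}. z j \<le> p j" "\<forall>i\<in>{1..d}. p i > 0 \<longrightarrow> p i \<le> z i"
    by auto
  \<comment> \<open>Where \<open>p j = 0\<close>, the bounds \<open>0 \<le> z j \<le> p j\<close>
    already force equality.\<close>
  have "z j = p j" if "j \<in> {1..d}" for j
    using z that C01[OF z(1) that] p01[OF that] by (cases "p j > 0") force+
  then have "z = p"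
    using z(1) cube p unfolding unit_cube_def by (intro PiE_ext) auto
  then show ?thesis using z(1) by simp
qed

theorem theorem8:
  fixes d :: nat
    and X :: "nat \<Rightarrow> (nat \<Rightarrow> real) set"
    and p :: "nat \<Rightarrow> real"
  assumes "d \<ge> 1"
    and "\<forall>i\<in>{0..d}. X i \<subseteq> unit_cube d"
    and "p \<in> unit_cube d"
    and "\<forall>i\<in>{0..d}. p \<in> mm_conv d (X i)"
  shows "\<exists>\<sigma> x. \<sigma> permutes {0..d} \<and>
           (\<forall>i\<in>index_set d p. x i \<in> X (\<sigma> i)) \<and>
           p \<in> mm_conv d (x ` index_set d p)"
proof -
  have I: "index_set d p \<subseteq> {0..d}"
    by (auto simp: index_set_def)
  have "\<forall>i\<in>index_set d p. \<exists>x. x \<in> X i \<and> x \<in> sector d p i"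
    using mem_mm_conv_meets_sector assms(2,4) I by blast
  then obtain x where x: "\<And>i. i \<in> index_set d p \<Longrightarrow> x i \<in> X i \<and> x i \<in> sector d p i"
    by metis
  have "x ` index_set d p \<subseteq> unit_cube d"
    using x assms(2) I by blast
  then have "mm_convex d (mm_conv d (x ` index_set d p))"
    by (rule mm_convex_mm_conv)
  \<comment> \<open>The criterion is applied with the hull itself as \<open>C\<close>; its
    generators witness the sectors.\<close>
  then have "p \<in> mm_conv d (x ` index_set d p)"
    using assms(3)
  proof (rule mm_convex_mem_if_meets_sectors)
    fix i assume i: "i \<in> index_set d p"
    then have "x i \<in> mm_conv d (x ` index_set d p)"
      by (intro subsetD[OF mm_conv_superset] imageI)
    with x[OF i] show "\<exists>y\<in>mm_conv d (x ` index_set d p). y \<in> sector d p i" by blast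
  qed
  then show ?thesis
    using x permutes_id[of "{0..d}"] by (intro exI[of _ id] exI[of _ x]) auto
qed

end
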